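(* $$\lim_{n\to\infty}\frac{\max\{\mathrm{uB}(T): T \text{ is a tree of order } n\}}{n^3}=\frac12 .$$
   Context: All graphs are finite, simple, and undirected; the order of a graph is its number of vertices. For a graph $G$ and two vertices $u,v$ of $G$, let $\mathrm{dist}_G(u,v)$ be the distance in $G$ between $u$ and $v$, and let $n_G(u,v)$ be the number of vertices $w$ of $G$ with $\mathrm{dist}_G(u,w)<\mathrm{dist}_G(v,w)$. The distance-unbalancedness of $G$ is $$\mathrm{uB}(G)=\sum_{\{u,v\}\in\binom{V(G)}{2}}|n_G(u,v)-n_G(v,u)|,$$ where $\binom{V(G)}{2}$ is the set of all $2$-element subsets of the vertex set $V(G)$ (all unordered pairs of distinct vertices, not only edges). *)

theory Defs
  imports "Graph_Theory.Graph_Theory" Complex_Main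
begin

text \<open>
  A finite simple undirected graph is a \<^locale>\<open>pair_graph\<close>: finite, loop-free, and with a
  symmetric arc set, so that an edge between \<open>u\<close> and \<open>v\<close> is stored as the two arcs
  \<open>(u, v)\<close> and \<open>(v, u)\<close>.
\<close>

text \<open>The distance is infinite when \<open>v\<close> cannot be reached from \<open>u\<close>.\<close>

definition gdist :: "'a pair_pre_digraph \<Rightarrow> 'a \<Rightarrow> 'a \<Rightarrow> ereal" where
  "gdist G u v = wf_digraph.\<mu> (with_proj G) (\<lambda>_. 1) u v"

definition closer_count :: "'a pair_pre_digraph \<Rightarrow> 'a \<Rightarrow> 'a \<Rightarrow> nat" where
  "closer_count G u v = card {w \<in> pverts G. gdist G u w < gdist G v w}"

text \<open>
  The summand is symmetric in \<open>u\<close> and \<open>v\<close>; the linear order on the vertices only serves to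
  take each unordered pair of distinct vertices exactly once.
\<close>

definition uB :: "'a::linorder pair_pre_digraph \<Rightarrow> int" where
  "uB G = (\<Sum>(u, v) | u \<in> pverts G \<and> v \<in> pverts G \<and> u < v.
             \<bar>int (closer_count G u v) - int (closer_count G v u)\<bar>)"

text \<open>
  The library predicate \<^const>\<open>Digraph_Component.tree\<close> is not usable here: in a symmetric digraph
  every edge, traversed back and forth, is a directed cycle of length 2. A cycle of an
  undirected graph is a directed cycle of length at least 3.
\<close>

definition undirected_tree :: "'a pair_pre_digraph \<Rightarrow> bool" where
  "undirected_tree T \<longleftrightarrow> pair_graph T \<and> Digraph_Component.connected (with_proj T) \<and>
     \<not> (\<exists>p. pre_digraph.cycle (with_proj T) p \<and> length p \<ge> 3)"

text \<open>
  Every finite graph is isomorphic to one whose vertices are natural numbers. There are infinitely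
  many such trees of order \<open>n\<close>, but their values \<^const>\<open>uB\<close> form a finite set, non-empty for
  \<open>n \<ge> 1\<close>.
\<close>

definition max_tree_uB :: "nat \<Rightarrow> int" where
  "max_tree_uB n = Max {uB T | T :: nat pair_pre_digraph.
                          undirected_tree T \<and> card (pverts T) = n}"

end

theory Submission
  imports Defs "HOL-Library.Discrete_Functions" "HOL-Real_Asymp.Real_Asymp"
begin

text \<open>
  In a graph with \<open>n\<close> vertices each of the at most \<open>n\<^sup>2 / 2\<close> pairs contributes at most \<open>n\<close> to the
  distance-unbalancedness, so \<open>n\<^sup>3 / 2\<close> is an upper bound for every order
  (\<open>two_uB_le_order_cubed\<close>).

  The bound is asymptotically attained by a spider with about \<open>\<surd>n\<close> legs, each of length about
  \<open>\<surd>n\<close>. If \<open>u\<close> is strictly closer to the centre than \<open>v\<close>, then every vertex \<open>w\<close> outside the leg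
  of \<open>v\<close> is closer to \<open>u\<close>: a shortest path from \<open>v\<close> to \<open>w\<close> has to pass the centre, and \<open>u\<close> can
  reach the centre faster. As a leg has only \<open>O(\<surd>n)\<close> vertices, such a pair contributes
  \<open>n - O(\<surd>n)\<close> (\<open>spider_imbalance\<close>). Each leg has at most one vertex of a given depth, so only
  \<open>O(n \<surd>n)\<close> of the pairs have equal depths, and all the others are of this kind
  (\<open>spider_uB_ge\<close>). The choice of \<open>\<surd>n\<close> legs balances the two losses: few legs keep the pairs of
  equal depth rare, short legs keep the imbalance of the remaining pairs large.

  Distances are never computed exactly. Upper bounds come from walking up to the centre and down
  again, lower bounds from potentials that grow by at most one along every edge
  (\<open>potential_le_gdist\<close>).
\<close>

section \<open>The upper bound\<close>

lemma uB_nonneg: "0 \<le> uB G"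
  unfolding uB_def by (rule sum_nonneg) auto

text \<open>
  The factor two arises because the pairs with \<open>u < v\<close> and their reversals are disjoint sets of
  ordered pairs, of which there are \<open>n\<^sup>2\<close> for \<open>n\<close> vertices.
\<close>

lemma two_uB_le_order_cubed:
  fixes G :: "'a::linorder pair_pre_digraph"
  assumes fin: "finite (pverts G)"
  shows "2 * uB G \<le> int (card (pverts G) ^ 3)"
proof -
  let ?V = "pverts G"
  define P where "P = {(u, v). u \<in> ?V \<and> v \<in> ?V \<and> u < v}"
  have P: "P \<subseteq> ?V \<times> ?V" by (auto simp: P_def)
  then have finP: "finite P" using fin by (meson finite_SigmaI finite_subset)
  have closer: "closer_count G u v \<le> card ?V" for u v
    unfolding closer_count_def using fin by (intro card_mono) auto
  have "uB G = (\<Sum>(u, v)\<in>P. \<bar>int (closer_count G u v) - int (closer_count G v u)\<bar>)"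
    by (simp add: uB_def P_def)
  also have "\<dots> \<le> (\<Sum>p\<in>P. int (card ?V))"
  proof (rule sum_mono)
    fix p assume "p \<in> P"
    obtain u v where [simp]: "p = (u, v)" by (cases p)
    show "(case p of (u, v) \<Rightarrow> \<bar>int (closer_count G u v) - int (closer_count G v u)\<bar>)
      \<le> int (card ?V)"
      using closer[of u v] closer[of v u] by simp
  qed
  finally have 1: "uB G \<le> int (card P) * int (card ?V)" by simp
  have "2 * card P = card P + card (prod.swap ` P)"
    by (simp add: card_image)
  also have "\<dots> = card (P \<union> prod.swap ` P)"
    by (rule card_Un_disjoint[symmetric]) (use finP in \<open>auto simp: P_def\<close>)
  also have "\<dots> \<le> card (?V \<times> ?V)"
    using P fin by (intro card_mono) auto
  finally have 2: "2 * card P \<le> card ?V * card ?V" by (simp add: card_cartesian_product)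
  have "2 * uB G \<le> int (2 * card P) * int (card ?V)" using 1 by simp
  also have "\<dots> \<le> int (card ?V * card ?V) * int (card ?V)"
    using 2 by (intro mult_right_mono) linarith+
  finally show ?thesis by (simp add: power3_eq_cube)
qed

section \<open>Distances and cycles\<close>

lemma gdist_le_length:
  assumes "wf_digraph (with_proj G)" "pre_digraph.awalk (with_proj G) u p v"
  shows "gdist G u v \<le> ereal (real (length p))"
proof -
  interpret wf_digraph "with_proj G" by fact
  have "awalk_cost (\<lambda>_. 1) p = real (length p)" by (induct p) auto
  then show ?thesis
    using min_cost_le_walk_cost[OF assms(2), of "\<lambda>_. 1"] by (simp add: gdist_def)
qed

text \<open>
  A walk of length \<open>m\<close> raises a function that grows by at most one along each arc by at most \<open>m\<close>.
  So every suitable \<open>f\<close> certifies a lower bound on a distance, without any knowledge of the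
  shortest paths.
\<close>

lemma potential_le_gdist:
  fixes f :: "'a \<Rightarrow> real"
  assumes wf: "wf_digraph (with_proj G)"
    and step: "\<And>x y. (x, y) \<in> parcs G \<Longrightarrow> f y \<le> f x + 1"
  shows "ereal (f v - f u) \<le> gdist G u v"
proof -
  interpret wf_digraph "with_proj G" by fact
  have "f v - f u \<le> awalk_cost (\<lambda>_. 1) p" if "awalk u p v" for p
    using that
  proof (induct p arbitrary: u)
    case (Cons e p)
    then have "f v - f (snd e) \<le> awalk_cost (\<lambda>_. 1) p" "(u, snd e) \<in> parcs G"
      by (auto simp: awalk_Cons_iff)
    then show ?case using step[of u "snd e"] by simp
  qed (simp add: awalk_Nil_iff)
  then show ?thesis
    unfolding gdist_def \<mu>_def by (intro INF_greatest) simp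
qed

text \<open>
  The largest vertex of a cycle has two neighbours on the cycle, both of them smaller than itself;
  they are distinct as soon as the cycle has at least three vertices.
\<close>

lemma no_long_cycle_if_unique_smaller_neighbour:
  fixes G :: "'a::linorder pair_pre_digraph"
  assumes G: "pair_graph G"
    and uniq: "\<And>x y z. (x, y) \<in> parcs G \<Longrightarrow> (x, z) \<in> parcs G \<Longrightarrow> y < x \<Longrightarrow> z < x \<Longrightarrow> y = z"
  shows "\<not> (\<exists>p. pre_digraph.cycle (with_proj G) p \<and> length p \<ge> 3)"
proof
  interpret pair_graph G by (rule G)
  assume "\<exists>p. pre_digraph.cycle (with_proj G) p \<and> length p \<ge> 3"
  then obtain p u where walk: "awalk u p u" and dist: "distinct (tl (awalk_verts u p))"
    and len: "length p \<ge> 3" by (auto simp: cycle_def)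
  define m where "m = length p"
  define b where "b i = snd (p ! i)" for i
  have m: "m \<ge> 3" using len by (simp add: m_def)
  have p_ne: "p \<noteq> []" using len by auto
  have arcs: "set p \<subseteq> parcs G" and cas: "pcas u p u" using walk by (auto simp: awalk_def)
  have consecutive: "Suc i < length q \<Longrightarrow> fst (q ! Suc i) = snd (q ! i)"
    if "pcas x q y" for q x y i
    using that
  proof (induct q arbitrary: x i)
    case (Cons e q)
    then show ?case by (cases i; cases q) auto
  qed simp
  have first: "fst (p ! 0) = u" using cas p_ne by (cases p) auto
  have last: "snd (p ! (length q - 1)) = y" if "pcas x q y" "q \<noteq> []" "q = p" for q x y
  proof -
    have "q \<noteq> [] \<Longrightarrow> snd (last q) = y" using \<open>pcas x q y\<close> by (induct q arbitrary: x) auto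
    then show ?thesis using that by (simp add: last_conv_nth)
  qed
  have "tl (awalk_verts u p) = map snd p"
    using awalk_verts_conv'[OF cas] p_ne by simp
  then have "distinct (map snd p)" using dist by simp
  then have inj: "b i = b j \<longleftrightarrow> i = j" if "i < m" "j < m" for i j
    using that by (auto simp: b_def m_def distinct_conv_nth)
  have pred: "(b (if i = 0 then m - 1 else i - 1), b i) \<in> parcs G" if "i < m" for i
  proof -
    have "fst (p ! i) = b (if i = 0 then m - 1 else i - 1)"
      using first last[OF cas p_ne refl] consecutive[OF cas, of "i - 1"] that
      by (auto simp: b_def m_def)
    then show ?thesis using arcs that nth_mem[of i p]
      by (metis b_def m_def prod.collapse subsetD)
  qed
  \<comment> \<open>Vertex \<open>i\<close> is the largest one; \<open>j\<close> and \<open>l\<close> are its cyclic predecessor and successor.\<close>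
  obtain i where i: "i < m" and max: "\<And>j. j < m \<Longrightarrow> b j \<le> b i"
  proof -
    have fin: "finite (b ` {..<m})" and ne: "b ` {..<m} \<noteq> {}" using m by (auto simp: lessThan_empty_iff)
    from Max_in[OF fin ne] obtain i where "i < m" "b i = Max (b ` {..<m})" by auto
    then show ?thesis using that Max_ge[OF fin] by (metis imageI lessThan_iff)
  qed
  define j where "j = (if i = 0 then m - 1 else i - 1)"
  define l where "l = (if i = m - 1 then 0 else Suc i)"
  have jl: "j < m" "l < m" "j \<noteq> l" "j \<noteq> i" "l \<noteq> i"
    using m i by (auto simp: j_def l_def split: if_splits)
  have "(b j, b i) \<in> parcs G" using pred[OF i] by (simp add: j_def)
  moreover have "(b i, b l) \<in> parcs G"
    using pred[OF jl(2)] m by (auto simp: l_def split: if_splits)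
  moreover have "b j < b i" "b l < b i"
    using max[of j] max[of l] inj[of j i] inj[of l i] jl i by (auto simp: order.strict_iff_order)
  ultimately have "b j = b l" using uniq arcs_symmetric by blast
  then show False using inj jl by blast
qed

section \<open>Trees given by a parent function\<close>

definition parent_graph :: "nat \<Rightarrow> (nat \<Rightarrow> nat) \<Rightarrow> nat pair_pre_digraph" where
  "parent_graph n par = \<lparr>pverts = {..<n},
     parcs = {(v, par v) | v. 0 < v \<and> v < n} \<union> {(par v, v) | v. 0 < v \<and> v < n}\<rparr>"

lemma parent_graph_simps [simp]:
  "pverts (parent_graph n par) = {..<n}"
  "(x, y) \<in> parcs (parent_graph n par) \<longleftrightarrow>
     0 < x \<and> x < n \<and> y = par x \<or> 0 < y \<and> y < n \<and> x = par y"
  by (auto simp: parent_graph_def)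

text \<open>
  Letting every parent be a smaller number makes \<open>0\<close> the root, and makes induction on the vertices
  available. The depth \<open>d\<close> is a parameter because concrete families have it in closed form.
\<close>

locale parent_tree =
  fixes n :: nat and par :: "nat \<Rightarrow> nat" and d :: "nat \<Rightarrow> nat"
  assumes nonempty: "0 < n"
    and par_less: "\<And>v. 0 < v \<Longrightarrow> v < n \<Longrightarrow> par v < v"
    and depth_root: "d 0 = 0"
    and depth_step: "\<And>v. 0 < v \<Longrightarrow> v < n \<Longrightarrow> d v = Suc (d (par v))"
begin

lemma pair_graph_parent_graph: "pair_graph (parent_graph n par)"
proof -
  have in_range: "x < n \<and> y < n \<and> x \<noteq> y"
    if arc: "(x, y) \<in> parcs (parent_graph n par)" for x y
  proof -
    consider "0 < x" "x < n" "y = par x" | "0 < y" "y < n" "x = par y"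
      using arc unfolding parent_graph_simps by blast
    then show ?thesis
    proof cases
      case 1
      show ?thesis using par_less[OF 1(1,2)] 1(2) unfolding 1(3) by linarith
    next
      case 2
      show ?thesis using par_less[OF 2(1,2)] 2(2) unfolding 2(3) by linarith
    qed
  qed
  have "parcs (parent_graph n par) \<subseteq> {..<n} \<times> {..<n}"
    by (rule subrelI) (use in_range in blast)
  then have "finite (parcs (parent_graph n par))"
    by (rule finite_subset) simp
  moreover have "symmetric (with_proj (parent_graph n par))"
    unfolding symmetric_def by (rule symI) (unfold with_proj_simps parent_graph_simps, blast)
  moreover have "fst e < n \<and> snd e < n \<and> fst e \<noteq> snd e" if "e \<in> parcs (parent_graph n par)" for e
    using in_range[of "fst e" "snd e"] that unfolding prod.collapse by blast
  ultimately show ?thesis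
    by unfold_locales (simp_all only: parent_graph_simps lessThan_iff finite_lessThan simp_thms)
qed

sublocale pair_graph "parent_graph n par"
  by (rule pair_graph_parent_graph)

lemma walk_to_root:
  assumes "v < n"
  shows "\<exists>p. awalk v p 0 \<and> length p = d v"
  using assms
proof (induct v rule: less_induct)
  case (less v)
  show ?case
  proof (cases "v = 0")
    case True
    then show ?thesis using nonempty depth_root by (auto simp: awalk_Nil_iff)
  next
    case False
    then have "par v < v" "par v < n" using par_less[of v] less.prems by auto
    then obtain p where "awalk (par v) p 0" "length p = d (par v)"
      using less.hyps by blast
    then have "awalk v ((v, par v) # p) 0 \<and> length ((v, par v) # p) = d v"
      using False less.prems depth_step[of v] by (simp add: awalk_Cons_iff)
    then show ?thesis by blast
  qed
qed

lemma walk_through_root: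
  assumes "u < n" "v < n"
  shows "\<exists>p. awalk u p v \<and> length p = d u + d v"
proof -
  have len: "length (rev_path q) = length q" for q :: "(nat \<times> nat) list" by (induct q) auto
  obtain p q where "awalk u p 0" "length p = d u" "awalk v q 0" "length q = d v"
    using walk_to_root assms by meson
  then have "awalk u (p @ rev_path q) v \<and> length (p @ rev_path q) = d u + d v"
    using awalk_appendI[of u p 0 "rev_path q" v] by (simp add: len)
  then show ?thesis by blast
qed

lemma gdist_le_depth_sum:
  assumes "u < n" "v < n"
  shows "gdist (parent_graph n par) u v \<le> ereal (real (d u + d v))"
  using walk_through_root[OF assms] gdist_le_length wf_digraph_axioms by metis

lemma undirected_tree_parent_graph: "undirected_tree (parent_graph n par)"
proof -
  have "u \<rightarrow>\<^sup>*\<^bsub>with_proj (parent_graph n par)\<^esub> v" if "u < n" "v < n" for u v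
    using walk_through_root[OF that] unfolding reachable_awalk by blast
  then have "Digraph_Component.connected (with_proj (parent_graph n par))"
    using nonempty reachable_mk_symmetricI
    by (auto simp: connected_def strongly_connected_def)
  moreover have "\<not> (\<exists>p. pre_digraph.cycle (with_proj (parent_graph n par)) p \<and> length p \<ge> 3)"
  proof (rule no_long_cycle_if_unique_smaller_neighbour[OF pair_graph_parent_graph])
    have smaller: "y = par x" if "(x, y) \<in> parcs (parent_graph n par)" "y < x" for x y
      using that par_less less_asym unfolding parent_graph_simps by blast
    show "y = z" if "(x, y) \<in> parcs (parent_graph n par)" "(x, z) \<in> parcs (parent_graph n par)"
      "y < x" "z < x" for x y z
      using smaller[OF that(1,3)] smaller[OF that(2,4)] by (rule trans[OF _ sym])
  qed
  ultimately show ?thesis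
    using pair_graph_parent_graph by (simp add: undirected_tree_def)
qed

end

section \<open>Spiders\<close>

text \<open>
  The spider with \<open>k\<close> legs, numbered breadth first: the centre is \<open>0\<close>, and its legs are the
  residue classes modulo \<open>k\<close> of the positive numbers. The truncated subtraction attaches the first \<open>k\<close> vertices to the centre.
\<close>

abbreviation spider :: "nat \<Rightarrow> nat \<Rightarrow> nat pair_pre_digraph" where
  "spider n k \<equiv> parent_graph n (\<lambda>v. v - k)"

definition spider_depth :: "nat \<Rightarrow> nat \<Rightarrow> nat" where
  "spider_depth k v = (v + k - 1) div k"

lemma spider_depth_0 [simp]: "spider_depth k 0 = 0"
  by (cases k) (auto simp: spider_depth_def)

lemma spider_depth_step:
  assumes "0 < k" "0 < v"
  shows "spider_depth k v = Suc (spider_depth k (v - k))"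
proof (cases "k \<le> v")
  case True
  then have "(v + k - 1) div k = (v - 1 + k) div k" using assms by simp
  also have "\<dots> = Suc ((v - 1) div k)"
    using assms(1) by (simp only: div_add_self2 neq0_conv Suc_eq_plus1)
  finally show ?thesis using True by (simp add: spider_depth_def)
next
  case False
  then have "(v + k - 1) div k = (v - 1 + k) div k" using assms by simp
  also have "\<dots> = Suc ((v - 1) div k)"
    using assms(1) by (simp only: div_add_self2 neq0_conv Suc_eq_plus1)
  finally show ?thesis using False by (simp add: spider_depth_def)
qed

lemma parent_tree_spider:
  assumes "0 < n" "0 < k"
  shows "parent_tree n (\<lambda>v. v - k) (spider_depth k)"
  using assms spider_depth_step by unfold_locales auto

lemma card_spider_depth_eq_le:
  assumes "0 < k"
  shows "card {v. v < n \<and> spider_depth k v = a} \<le> k"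
proof -
  have "{v. v < n \<and> spider_depth k v = a} \<subseteq> {k * a + 1 - k..<k * a + 1}"
  proof
    fix v assume "v \<in> {v. v < n \<and> spider_depth k v = a}"
    then have "(v + k - 1) div k = a" by (simp add: spider_depth_def)
    then have "k * a \<le> v + k - 1" "v + k - 1 < k * a + k"
      using assms dividend_less_times_div[of k "v + k - 1"] by auto
    then show "v \<in> {k * a + 1 - k..<k * a + 1}" by auto
  qed
  then have "card {v. v < n \<and> spider_depth k v = a} \<le> card {k * a + 1 - k..<k * a + 1}"
    by (intro card_mono) auto
  then show ?thesis by simp
qed

lemma card_residue_class_le:
  fixes n k r :: nat
  shows "card {v. v < n \<and> v mod k = r} \<le> n div k + 1"
proof -
  have "inj_on (\<lambda>v. v div k) {v. v < n \<and> v mod k = r}"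
    by (rule inj_onI) (metis (mono_tags, lifting) div_mult_mod_eq mem_Collect_eq)
  then have "card {v. v < n \<and> v mod k = r} = card ((\<lambda>v. v div k) ` {v. v < n \<and> v mod k = r})"
    by (simp add: card_image)
  also have "\<dots> \<le> card {..n div k}"
    by (intro card_mono) (auto intro: div_le_mono)
  finally show ?thesis by simp
qed

text \<open>
  The potential is the depth, counted negatively on the leg of \<open>v\<close>: along a walk that leaves this
  leg it first rises to zero at the centre and then to the depth of the final vertex.
\<close>

lemma depth_sum_le_spider_gdist:
  assumes "0 < n" "0 < k" and "v mod k \<noteq> w mod k"
  shows "ereal (real (spider_depth k v + spider_depth k w)) \<le> gdist (spider n k) v w"
proof -
  interpret parent_tree n "\<lambda>v. v - k" "spider_depth k" using assms by (intro parent_tree_spider)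
  define f where "f x = (if x mod k = v mod k then - real (spider_depth k x)
    else real (spider_depth k x))" for x
  have step: "\<bar>f x - f (x - k)\<bar> \<le> 1" if "0 < x" for x
  proof (cases "k \<le> x")
    case True
    then have "(x - k) mod k = x mod k" by (simp add: le_mod_geq)
    then show ?thesis using spider_depth_step[OF assms(2) that] by (simp add: f_def)
  next
    case False
    then have "f (x - k) = 0" by (simp add: f_def)
    moreover have "\<bar>f x\<bar> = 1"
      using False spider_depth_step[OF assms(2) that] by (auto simp: f_def)
    ultimately show ?thesis by simp
  qed
  have "f y \<le> f x + 1" if "(x, y) \<in> parcs (spider n k)" for x y
    using that step[of x] step[of y] by (auto simp: abs_le_iff)
  then have "ereal (f w - f v) \<le> gdist (spider n k) v w"
    by (rule potential_le_gdist[OF wf_digraph_axioms])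
  then show ?thesis using assms(3) by (simp add: f_def add.commute)
qed

lemma spider_closer_outside_leg:
  assumes "0 < n" "0 < k" "u < n" "w < n"
    and "spider_depth k u < spider_depth k v" "w mod k \<noteq> v mod k"
  shows "gdist (spider n k) u w < gdist (spider n k) v w"
proof -
  interpret parent_tree n "\<lambda>v. v - k" "spider_depth k" using assms by (intro parent_tree_spider)
  have "gdist (spider n k) u w \<le> ereal (real (spider_depth k u + spider_depth k w))"
    using assms by (intro gdist_le_depth_sum)
  also have "\<dots> < ereal (real (spider_depth k v + spider_depth k w))"
    using assms by simp
  also have "\<dots> \<le> gdist (spider n k) v w"
    using assms by (intro depth_sum_le_spider_gdist) auto
  finally show ?thesis .
qed

text \<open>
  A leg has at most \<open>L = n div k + 1\<close> vertices. All vertices outside the leg of \<open>v\<close>, at least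
  \<open>n - L\<close>, are closer to \<open>u\<close>, which leaves at most \<open>L\<close> that are closer to \<open>v\<close>.
\<close>

lemma spider_imbalance_aux:
  assumes "0 < n" "0 < k" "u < n" "v < n" and less: "spider_depth k u < spider_depth k v"
  shows "int n - 2 * int (n div k + 1)
    \<le> int (closer_count (spider n k) u v) - int (closer_count (spider n k) v u)"
proof -
  define A where "A = {w. w < n \<and> w mod k = v mod k}"
  have A: "A \<subseteq> {..<n}" "card A \<le> n div k + 1"
    using card_residue_class_le by (auto simp: A_def)
  have "closer_count (spider n k) v u \<le> card A"
    unfolding closer_count_def
    using spider_closer_outside_leg[OF assms(1-3) _ less]
    by (intro card_mono) (auto simp: A_def dest: less_asym)
  moreover have "card ({..<n} - A) \<le> closer_count (spider n k) u v"
    unfolding closer_count_def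
    using spider_closer_outside_leg[OF assms(1-3) _ less]
    by (intro card_mono) (auto simp: A_def)
  moreover have "card ({..<n} - A) = n - card A"
    using A by (simp add: card_Diff_subset finite_subset)
  ultimately have "n \<le> closer_count (spider n k) u v + (n div k + 1)"
    "closer_count (spider n k) v u \<le> n div k + 1"
    using A(2) by simp_all
  moreover have "int n - 2 * int L \<le> int a - int b" if "n \<le> a + L" "b \<le> L" for a b L
    using that by linarith
  ultimately show ?thesis by blast
qed

lemma spider_imbalance:
  assumes "0 < n" "0 < k" "u < n" "v < n" "spider_depth k u \<noteq> spider_depth k v"
  shows "int n - 2 * int (n div k + 1)
    \<le> \<bar>int (closer_count (spider n k) u v) - int (closer_count (spider n k) v u)\<bar>"
  using spider_imbalance_aux[of n k u v] spider_imbalance_aux[of n k v u] assms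
  by (cases "spider_depth k u < spider_depth k v") auto

text \<open>
  For fixed \<open>u\<close>, at most \<open>k\<close> of the \<open>n - 1 - u\<close> larger vertices have the same depth as \<open>u\<close>;
  each of the others contributes at least \<open>n - 2 (n div k + 1)\<close>. The last hypothesis says that this
  is not negative, so that a lower bound on the number of the others yields one on their sum.
\<close>

lemma spider_uB_ge:
  assumes "0 < n" "0 < k" and legs: "2 * (n div k + 1) \<le> n"
  shows "(real n * (real n - 1) / 2 - real n * real k) * (real n - 2 * real (n div k + 1))
    \<le> real_of_int (uB (spider n k))"
proof -
  let ?g = "\<lambda>u v. \<bar>int (closer_count (spider n k) u v) - int (closer_count (spider n k) v u)\<bar>"
  define c where "c = int n - 2 * int (n div k + 1)"
  have c0: "0 \<le> c" using legs by (simp add: c_def)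
  have row: "(int (n - Suc u) - int k) * c \<le> (\<Sum>v | v < n \<and> u < v. ?g u v)" if u: "u < n" for u
  proof -
    define E where "E = {v. v < n \<and> spider_depth k v = spider_depth k u}"
    have "card {u<..<n} - card E \<le> card ({u<..<n} - E)"
      by (rule diff_card_le_card_Diff) (simp add: E_def)
    then have "int (n - Suc u) - int k \<le> int (card ({u<..<n} - E))"
      using card_spider_depth_eq_le[OF assms(2), of n "spider_depth k u"] by (simp add: E_def)
    then have "(int (n - Suc u) - int k) * c \<le> int (card ({u<..<n} - E)) * c"
      using c0 by (rule mult_right_mono)
    also have "\<dots> = (\<Sum>v\<in>{u<..<n} - E. c)" by simp
    also have "\<dots> \<le> (\<Sum>v\<in>{u<..<n} - E. ?g u v)"
      using spider_imbalance[OF assms(1,2) u] by (intro sum_mono) (auto simp: c_def E_def)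
    also have "\<dots> \<le> (\<Sum>v | v < n \<and> u < v. ?g u v)"
      by (intro sum_mono2) auto
    finally show ?thesis .
  qed
  have "(\<Sum>u<n. (int (n - Suc u) - int k) * c) \<le> (\<Sum>u<n. \<Sum>v | v < n \<and> u < v. ?g u v)"
    using row by (intro sum_mono) auto
  also have "\<dots> = (\<Sum>(u, v)\<in>(SIGMA u:{..<n}. {v. v < n \<and> u < v}). ?g u v)"
    by (rule sum.Sigma) auto
  also have "(SIGMA u:{..<n}. {v. v < n \<and> u < v}) = {(u, v). u \<in> {..<n} \<and> v \<in> {..<n} \<and> u < v}"
    by auto
  finally have uB: "(\<Sum>u<n. (int (n - Suc u) - int k) * c) \<le> uB (spider n k)"
    by (simp add: uB_def)
  have "2 * (\<Sum>u<n. int (n - Suc u)) = 2 * (\<Sum>u<n. int u)"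
    using sum.nat_diff_reindex[of int n] by simp
  also have "\<dots> = int n * (int n - 1)"
    by (induct n) (auto simp: algebra_simps)
  finally have gauss: "2 * (\<Sum>u<n. int (n - Suc u)) = int n * (int n - 1)" .
  have "2 * (\<Sum>u<n. (int (n - Suc u) - int k) * c) = (int n * (int n - 1) - 2 * int n * int k) * c"
    using gauss by (simp add: sum_subtractf flip: sum_distrib_right)
  then have "(int n * (int n - 1) - 2 * int n * int k) * c \<le> 2 * uB (spider n k)"
    using uB by linarith
  then have "real_of_int ((int n * (int n - 1) - 2 * int n * int k) * c)
    \<le> real_of_int (2 * uB (spider n k))"
    by (simp only: of_int_le_iff)
  then show ?thesis by (simp add: c_def field_simps)
qed

section \<open>The limit\<close>

text \<open>There are infinitely many trees here, but the upper bound confines their integer values.\<close>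

lemma finite_tree_uB_values:
  "finite {uB T | T :: nat pair_pre_digraph. undirected_tree T \<and> card (pverts T) = n}"
proof (rule finite_subset)
  show "{uB T | T :: nat pair_pre_digraph. undirected_tree T \<and> card (pverts T) = n}
    \<subseteq> {0..int (n ^ 3)}"
  proof clarify
    fix T :: "nat pair_pre_digraph"
    assume "undirected_tree T" and n: "n = card (pverts T)"
    then interpret pair_graph T by (simp add: undirected_tree_def)
    show "uB T \<in> {0..int (card (pverts T) ^ 3)}"
      using two_uB_le_order_cubed[of T] uB_nonneg[of T] pair_finite_verts by simp
  qed
qed simp

lemma max_tree_uB_le:
  assumes "0 < n"
  shows "real_of_int (max_tree_uB n) \<le> real n ^ 3 / 2"
proof -
  \<comment> \<open>The spider with one leg, a path, witnesses that there is a tree of order \<open>n\<close>.\<close>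
  interpret parent_tree n "\<lambda>v. v - 1" "spider_depth 1" using assms by (intro parent_tree_spider) auto
  let ?S = "{uB T | T :: nat pair_pre_digraph. undirected_tree T \<and> card (pverts T) = n}"
  have "?S \<noteq> {}" using undirected_tree_parent_graph by fastforce
  then have "max_tree_uB n \<in> ?S"
    unfolding max_tree_uB_def by (intro Max_in finite_tree_uB_values)
  then obtain T :: "nat pair_pre_digraph"
    where T: "max_tree_uB n = uB T" "undirected_tree T" "card (pverts T) = n" by auto
  then interpret T: pair_graph T by (simp add: undirected_tree_def)
  have "2 * uB T \<le> int (n ^ 3)"
    using two_uB_le_order_cubed[of T] T.pair_finite_verts T(3) by simp
  then have "real_of_int (2 * uB T) \<le> real_of_int (int (n ^ 3))"
    by (simp only: of_int_le_iff)
  then show ?thesis using T(1) by simp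
qed

lemma spider_le_max_tree_uB:
  assumes "0 < n" "0 < k"
  shows "uB (spider n k) \<le> max_tree_uB n"
proof -
  interpret parent_tree n "\<lambda>v. v - k" "spider_depth k" using assms by (rule parent_tree_spider)
  show ?thesis unfolding max_tree_uB_def
    using undirected_tree_parent_graph
    by (intro Max_ge finite_tree_uB_values) fastforce
qed

lemma div_floor_sqrt_le:
  assumes "0 < n"
  shows "n div floor_sqrt n \<le> floor_sqrt n + 2"
proof -
  define k where "k = floor_sqrt n"
  have k: "0 < k" using assms by (simp add: k_def)
  have "n < (k + 3) * k"
    using Suc_floor_sqrt_power2_gt[of n] k unfolding k_def[symmetric]
    by (simp add: power2_eq_square algebra_simps)
  then have "n div k < k + 3" using k by (simp add: div_less_iff_less_mult)
  then show ?thesis by (simp add: k_def)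
qed

text \<open>
  This is \<open>spider_uB_ge\<close> for \<open>k = floor_sqrt n\<close>. The threshold makes both factors non-negative, so
  that the number of legs and the bound on their length may be replaced by the estimates \<open>\<surd>n\<close> and
  \<open>\<surd>n + 3\<close>.
\<close>

lemma max_tree_uB_ge:
  assumes n: "100 \<le> n"
  shows "(real n * (real n - 1) / 2 - real n * sqrt (real n)) * (real n - 2 * sqrt (real n) - 6)
    \<le> real_of_int (max_tree_uB n)"
proof -
  define k where "k = floor_sqrt n"
  define s where "s = sqrt (real n)"
  have s2: "s * s = real n" by (simp add: s_def)
  have s10: "10 \<le> s" unfolding s_def using n by (intro real_le_rsqrt) simp
  then have s: "10 * s \<le> real n" using mult_right_mono[of 10 s s] s2 by simp
  have k0: "0 < k" using n by (simp add: k_def)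
  have "real (k\<^sup>2) \<le> real n" unfolding k_def of_nat_le_iff by simp
  then have ks: "real k \<le> s" unfolding s_def by (intro real_le_rsqrt) simp
  have div: "n div k \<le> k + 2" using div_floor_sqrt_le[of n] n by (simp add: k_def)
  then have div_s: "real (n div k + 1) \<le> s + 3" using ks by linarith
  have "real (2 * (n div k + 1)) \<le> real n" using div_s s s10 by (simp add: algebra_simps)
  then have le: "2 * (n div k + 1) \<le> n" by linarith
  have "0 \<le> real n * ((real n - 1) / 2 - s)"
    using s n by (intro mult_nonneg_nonneg) auto
  then have nonneg: "0 \<le> real n * (real n - 1) / 2 - real n * s"
    by (simp add: algebra_simps)
  have mono1: "real n * real k \<le> real n * s" using ks by (intro mult_left_mono) auto
  have "(real n * (real n - 1) / 2 - real n * s) * (real n - 2 * s - 6)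
    \<le> (real n * (real n - 1) / 2 - real n * real k) * (real n - 2 * real (n div k + 1))"
    by (rule mult_mono) (use nonneg mono1 div_s s n in auto)
  also have "\<dots> \<le> real_of_int (uB (spider n k))"
    using n k0 le by (intro spider_uB_ge) auto
  also have "\<dots> \<le> real_of_int (max_tree_uB n)"
    using spider_le_max_tree_uB[of n k] n k0 by simp
  finally show ?thesis by (simp add: s_def)
qed

theorem corollary1:
  shows "(\<lambda>n. real_of_int (max_tree_uB n) / real n ^ 3) \<longlonglongrightarrow> 1 / 2"
proof (rule tendsto_sandwich)
  show "(\<lambda>n. (real n * (real n - 1) / 2 - real n * sqrt (real n))
      * (real n - 2 * sqrt (real n) - 6) / real n ^ 3) \<longlonglongrightarrow> 1 / 2"
    by real_asymp
  show "\<forall>\<^sub>F n in sequentially. (real n * (real n - 1) / 2 - real n * sqrt (real n))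
      * (real n - 2 * sqrt (real n) - 6) / real n ^ 3 \<le> real_of_int (max_tree_uB n) / real n ^ 3"
    using eventually_ge_at_top[of "100::nat"]
    by eventually_elim (intro divide_right_mono max_tree_uB_ge, auto)
  show "\<forall>\<^sub>F n in sequentially. real_of_int (max_tree_uB n) / real n ^ 3 \<le> 1 / 2"
    using eventually_gt_at_top[of "0::nat"]
  proof eventually_elim
    case (elim n)
    then show ?case using max_tree_uB_le[of n] by (simp add: field_simps)
  qed
qed simp

end
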